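(* For every $k \geq 2$ and every $n \geq 2k+2$, $\mathrm{lir}(C_n^k) = 2$.
   Context: $C_n^k$ denotes the $k$-th power of the cycle $C_n$: the graph on the vertices of $C_n$ in which two distinct vertices are adjacent iff their distance in $C_n$ is at most $k$. A graph is locally irregular if the two endvertices of every edge have different degrees. $\mathrm{lir}(G)$ is the minimum number of colors in an edge coloring of $G$ in which every color class induces a locally irregular subgraph. *)

theory Defs
  imports Main "HOL-Library.Extended_Nat"
begin

text \<open>Finite simple graphs: edges are two-element sets of vertices.\<close>

record 'a ugraph =
  vertices :: "'a set"
  edges :: "'a set set"

definition degree :: "'a ugraph \<Rightarrow> 'a \<Rightarrow> nat" where
  "degree G v = card {e \<in> edges G. v \<in> e}"

definition is_walk :: "'a ugraph \<Rightarrow> 'a \<Rightarrow> 'a list \<Rightarrow> 'a \<Rightarrow> bool" where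
  "is_walk G u p v \<longleftrightarrow>
     p \<noteq> [] \<and> hd p = u \<and> last p = v \<and> set p \<subseteq> vertices G \<and>
     successively (\<lambda>x y. {x, y} \<in> edges G) p"

text \<open>The length of a walk is its number of edges. The distance of two vertices in different
  components is infinite (infimum of the empty set).\<close>

definition gdist :: "'a ugraph \<Rightarrow> 'a \<Rightarrow> 'a \<Rightarrow> enat" where
  "gdist G u v = (INF p\<in>{p. is_walk G u p v}. enat (length p - 1))"

definition graph_power :: "'a ugraph \<Rightarrow> nat \<Rightarrow> 'a ugraph" where
  "graph_power G k =
     \<lparr>vertices = vertices G,
      edges = {{u, v} | u v. u \<in> vertices G \<and> v \<in> vertices G \<and> u \<noteq> v \<and> gdist G u v \<le> enat k}\<rparr>"

text \<open>Meaningful for \<open>n \<ge> 3\<close>: for smaller \<open>n\<close> this is not a cycle.\<close>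

definition cycle_graph :: "nat \<Rightarrow> nat ugraph" where
  "cycle_graph n = \<lparr>vertices = {..<n}, edges = {{i, Suc i mod n} | i. i < n}\<rparr>"

definition edge_induced :: "'a set set \<Rightarrow> 'a ugraph" where
  "edge_induced F = \<lparr>vertices = \<Union>F, edges = F\<rparr>"

definition locally_irregular :: "'a ugraph \<Rightarrow> bool" where
  "locally_irregular G \<longleftrightarrow> (\<forall>u v. {u, v} \<in> edges G \<longrightarrow> degree G u \<noteq> degree G v)"

text \<open>The coloring need not be proper. Unused colors are allowed, which does not affect the
  minimum number of colors.\<close>

definition locally_irregular_coloring :: "'a ugraph \<Rightarrow> nat \<Rightarrow> ('a set \<Rightarrow> nat) \<Rightarrow> bool" where
  "locally_irregular_coloring G m c \<longleftrightarrow>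
     c ` edges G \<subseteq> {..<m} \<and>
     (\<forall>i<m. locally_irregular (edge_induced {e \<in> edges G. c e = i}))"

text \<open>Some graphs have no such coloring at all; their value is infinity, so an equation with a
  finite value includes the existence of a coloring.\<close>

definition lir :: "'a ugraph \<Rightarrow> enat" where
  "lir G = (INF m\<in>{m. \<exists>c. locally_irregular_coloring G m c}. enat m)"

end

theory Submission
  imports Defs
begin

text \<open>Since \<open>C\<^sub>n\<^sup>k\<close> is \<open>2k\<close>-regular, it suffices to find a set of red edges such that the red degree
  is a proper vertex coloring of \<open>C\<^sub>n\<^sup>k\<close>.

  Cut the cycle into at least two blocks of length \<open>l\<close> or \<open>l + 1\<close>, where \<open>k < l \<le> (3k + 1) / 2\<close>.
  The extra vertex of a long block gets no red edge, and the red degree of any other vertex is made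
  a positive injective function of its position \<open>p < l\<close> in its block. Equal red degrees then occur
  only at equal positions of different blocks, hence at distance more than \<open>k\<close>.

  To obtain this function, give the positions distinct weights \<open>1, \<dots>, l\<close> and join two positions
  if their weights sum to more than \<open>l\<close>; the edge is realised inside the block when the positions
  differ by at most \<open>k\<close>, and otherwise between consecutive blocks. A position of weight \<open>w\<close> has
  threshold degree \<open>w\<close> or \<open>w - 1\<close>, the latter for the heavier half of the weights. The deficit is
  repaired by a perfect matching of the heavy positions, realised between consecutive blocks in
  addition to the threshold edge inside the block. If the number of heavy positions is odd, the
  heaviest one is matched twice. Only \<open>k = 3\<close>, \<open>n = 11\<close> does not leave enough room for this.\<close>

section \<open>Edges of a cycle power as displacements modulo \<open>n\<close>\<close>

text \<open>Each step of a walk moves by \<open>1\<close> or \<open>-1\<close> modulo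
  \<open>n\<close>, and \<open>s\<close> is the sum of the steps.\<close>

lemma walk_in_cycle_displacement:
  assumes "is_walk (cycle_graph n) u p v"
  shows "\<exists>s::int. \<bar>s\<bar> \<le> int (length p - 1) \<and> int v = (int u + s) mod int n"
  using assms
proof (induction p arbitrary: u)
  case Nil
  then show ?case by (simp add: is_walk_def)
next
  case (Cons x p)
  have x: "x = u" "u < n"
    using Cons.prems by (auto simp: is_walk_def cycle_graph_def)
  show ?case
  proof (cases p)
    case Nil
    then show ?thesis
      using Cons.prems x by (intro exI[of _ 0]) (auto simp: is_walk_def)
  next
    case (Cons y p')
    have walk: "is_walk (cycle_graph n) y p v" and step: "{u, y} \<in> edges (cycle_graph n)"
      using Cons.prems x Cons by (auto simp: is_walk_def)
    then obtain s :: int where s: "\<bar>s\<bar> \<le> int (length p - 1)" "int v = (int y + s) mod int n"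
      using Cons.IH by blast
    from step consider "y = Suc u mod n" | "u = Suc y mod n" "y < n"
      by (auto simp: cycle_graph_def doubleton_eq_iff)
    then show ?thesis
    proof cases
      case 1
      then have "int v = (int u + (s + 1)) mod int n"
        using s(2) by (simp add: zmod_int mod_simps add_ac)
      then show ?thesis
        using s(1) Cons by (intro exI[of _ "s + 1"]) auto
    next
      case 2
      then have "(int u + (s - 1)) mod int n = (int y + s) mod int n"
        by (simp add: zmod_int mod_simps algebra_simps)
          (metis add.commute add_diff_cancel_left' diff_add_eq mod_add_left_eq)
      then show ?thesis
        using s Cons by (intro exI[of _ "s - 1"]) auto
    qed
  qed
qed

lemma gdist_cycle_le:
  assumes "u < n"
  shows "gdist (cycle_graph n) u ((u + d) mod n) \<le> enat d"
proof -
  let ?p = "\<lambda>d. map (\<lambda>i. (u + i) mod n) [0..<Suc d]"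
  have "successively (\<lambda>x y. {x, y} \<in> edges (cycle_graph n)) (?p d)"
  proof (induction d)
    case (Suc d)
    have "{(u + d) mod n, (u + Suc d) mod n} \<in> edges (cycle_graph n)"
      using assms by (auto simp: cycle_graph_def mod_Suc_eq intro!: exI[of _ "(u + d) mod n"])
    then show ?case
      using Suc by (auto simp: successively_append_iff)
  qed auto
  then have "is_walk (cycle_graph n) u (?p d) ((u + d) mod n)"
    using assms by (auto simp: is_walk_def cycle_graph_def hd_map last_map simp del: upt_Suc)
  then have "gdist (cycle_graph n) u ((u + d) mod n) \<le> enat (length (?p d) - 1)"
    unfolding gdist_def by (intro INF_lower) simp
  then show ?thesis by simp
qed

text \<open>A walk of length at most \<open>k\<close> has a displacement \<open>s\<close> of
  absolute value at most \<open>k\<close>; its sign decides which end of the edge serves as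
  \<open>u\<close>.\<close>

lemma cycle_power_edges:
  assumes "k < n"
  shows "edges (graph_power (cycle_graph n) k) = {{u, (u + d) mod n} | u d. u < n \<and> 0 < d \<and> d \<le> k}"
    (is "?L = ?R")
proof (intro subset_antisym subsetI)
  fix e assume "e \<in> ?L"
  then obtain u v where e: "e = {u, v}" "u < n" "v < n" "u \<noteq> v"
    and dist: "gdist (cycle_graph n) u v \<le> enat k"
    by (auto simp: graph_power_def cycle_graph_def)
  obtain p where p: "is_walk (cycle_graph n) u p v" "length p - 1 \<le> k"
  proof -
    have "gdist (cycle_graph n) u v < enat (Suc k)"
      using dist by (metis enat_ord_simps(2) lessI order_le_less_trans)
    then show thesis
      using that by (auto simp: gdist_def INF_less_iff less_Suc_eq_le)
  qed
  then obtain s :: int where s: "\<bar>s\<bar> \<le> int k" "int v = (int u + s) mod int n"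
    using walk_in_cycle_displacement[OF p(1)] p(2) by (meson of_nat_mono order_trans)
  have "s \<noteq> 0"
    using s(2) e by (auto simp flip: zmod_int)
  show "e \<in> ?R"
  proof (cases "s > 0")
    case True
    then have "int v = int ((u + nat s) mod n)"
      using s(2) by (simp add: zmod_int)
    then have "v = (u + nat s) mod n"
      by (simp only: of_nat_eq_iff)
    then show ?thesis
      using e(1,2) s(1) True by (intro CollectI exI[of _ u] exI[of _ "nat s"]) simp
  next
    case False
    have "(int v + - s) mod int n = int u mod int n"
      using s(2) by (simp add: mod_simps)
    then have "int u = int ((v + nat (- s)) mod n)"
      using False e(2) by (simp add: zmod_int)
    then have "u = (v + nat (- s)) mod n"
      by (simp only: of_nat_eq_iff)
    then show ?thesis
      using e(1,3) s(1) False \<open>s \<noteq> 0\<close>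
      by (intro CollectI exI[of _ v] exI[of _ "nat (- s)"]) (simp add: insert_commute)
  qed
next
  fix e assume "e \<in> ?R"
  then obtain u d where e: "e = {u, (u + d) mod n}" "u < n" "0 < d" "d \<le> k"
    by blast
  have "(u + d) mod n \<noteq> u"
    using e assms by (auto simp: mod_if)
  moreover have "gdist (cycle_graph n) u ((u + d) mod n) \<le> enat k"
    using gdist_cycle_le[OF e(2), of d] e(4) by (meson enat_ord_simps(1) order_trans)
  ultimately show "e \<in> ?L"
    using e by (fastforce simp: graph_power_def cycle_graph_def)
qed

section \<open>Degrees in a cycle power\<close>

lemma degree_eq_card_neighbours:
  assumes "\<And>e. e \<in> edges G \<Longrightarrow> card e = 2"
  shows "degree G v = card {w. {v, w} \<in> edges G}"
proof -
  have "bij_betw (\<lambda>w. {v, w}) {w. {v, w} \<in> edges G} {e \<in> edges G. v \<in> e}"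
  proof (intro bij_betwI' CollectI)
    fix e assume "e \<in> {e \<in> edges G. v \<in> e}"
    then show "\<exists>w\<in>{w. {v, w} \<in> edges G}. e = {v, w}"
      using assms[of e] by (auto simp: card_2_iff insert_commute)
  qed (auto simp: doubleton_eq_iff)
  then show ?thesis
    by (simp add: degree_def bij_betw_same_card)
qed

lemma card_cycle_power_edge:
  assumes "k < n" "e \<in> edges (graph_power (cycle_graph n) k)"
  shows "card e = 2"
  using assms(2) by (auto simp: graph_power_def card_2_iff)

text \<open>A step back by \<open>d\<close> is a step forward by \<open>n - d\<close>, so forward
  displacements reach all neighbours.\<close>

lemma cycle_power_edge_iff:
  assumes "k < n" "v < n"
  shows "{v, w} \<in> edges (graph_power (cycle_graph n) k) \<longleftrightarrow>
    (\<exists>d. (0 < d \<and> d \<le> k \<or> n - k \<le> d \<and> d < n) \<and> w = (v + d) mod n)"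
    (is "?L \<longleftrightarrow> ?R")
proof
  assume ?L
  then obtain u d where d: "u < n" "0 < d" "d \<le> k" "{v, w} = {u, (u + d) mod n}"
    using cycle_power_edges[OF assms(1)] by auto
  from d(4) consider "v = u" "w = (u + d) mod n" | "w = u" "v = (u + d) mod n"
    by (auto simp: doubleton_eq_iff)
  then show ?R
  proof cases
    case 1
    then show ?thesis using d by auto
  next
    case 2
    then have "w = (v + (n - d)) mod n"
      using d(1-3) assms by (auto simp: mod_if)
    then show ?thesis using d assms by (intro exI[of _ "n - d"]) auto
  qed
next
  assume ?R
  then obtain d where d: "w = (v + d) mod n" "0 < d \<and> d \<le> k \<or> n - k \<le> d \<and> d < n"
    by blast
  from d(2) show ?L
  proof
    assume "0 < d \<and> d \<le> k"
    then show ?L using d assms by (auto simp: cycle_power_edges)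
  next
    assume *: "n - k \<le> d \<and> d < n"
    then have "v = (w + (n - d)) mod n" "w < n"
      using d(1) assms by (auto simp: mod_if)
    then have "{v, w} = {w, (w + (n - d)) mod n} \<and> w < n \<and> 0 < n - d \<and> n - d \<le> k"
      using * by auto
    then show ?L unfolding cycle_power_edges[OF assms(1)] by blast
  qed
qed

lemma degree_cycle_power:
  assumes "2 * k < n" "v < n"
  shows "degree (graph_power (cycle_graph n) k) v = 2 * k"
proof -
  let ?D = "{1..k} \<union> {n - k..<n}"
  have "{w. {v, w} \<in> edges (graph_power (cycle_graph n) k)} = (\<lambda>d. (v + d) mod n) ` ?D"
    using assms by (auto simp: cycle_power_edge_iff Bex_def image_iff Suc_le_eq)
  moreover have "inj_on (\<lambda>d. (v + d) mod n) ?D"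
  proof (rule inj_onI)
    fix x y assume xy: "x \<in> ?D" "y \<in> ?D" "(v + x) mod n = (v + y) mod n"
    then have "x < n" "y < n" using assms by auto
    then show "x = y"
      using xy(3) assms(2) by (auto simp: mod_if split: if_splits)
  qed
  moreover have "card ?D = 2 * k"
    using assms by (subst card_Un_disjoint) auto
  ultimately show ?thesis
    using assms degree_eq_card_neighbours[OF card_cycle_power_edge[of k n], where v = v]
    by (simp add: card_image)
qed


section \<open>Reduction to a single red graph\<close>

text \<open>In a regular graph the two degrees of a vertex with respect to complementary color classes
  have a constant sum, so both classes are locally irregular as soon as the degrees within the
  first class differ along every edge of the whole graph.\<close>

lemma lir_cycle_power_eq_2I:
  fixes \<rho> :: "nat \<Rightarrow> nat \<Rightarrow> bool"
  assumes "0 < k" "2 * k < n"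
    and sym: "\<And>u v. \<rho> u v \<Longrightarrow> \<rho> v u"
    and sub: "\<And>u v. \<rho> u v \<Longrightarrow> {u, v} \<in> edges (graph_power (cycle_graph n) k)"
    and proper: "\<And>u v. {u, v} \<in> edges (graph_power (cycle_graph n) k) \<Longrightarrow>
      card {w. \<rho> u w} \<noteq> card {w. \<rho> v w}"
  shows "lir (graph_power (cycle_graph n) k) = 2"
proof -
  define G where "G = graph_power (cycle_graph n) k"
  have edge01: "{0, 1} \<in> edges G"
    unfolding G_def using assms(1,2) by (simp add: cycle_power_edge_iff exI[of _ 1])
  have vert: "v < n" if "{u, v} \<in> edges G" for u v
    using that by (auto simp: G_def graph_power_def cycle_graph_def doubleton_eq_iff)
  have deg: "degree G v = 2 * k" if "v < n" for v
    using that assms(2) by (simp add: G_def degree_cycle_power)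
  have card2: "card e = 2" if "e \<in> edges G" for e
    using card_cycle_power_edge[of k n e] that assms(2) by (simp add: G_def)
  have fin: "finite (edges G)"
  proof (rule finite_subset)
    show "edges G \<subseteq> Pow {..<n}"
      by (auto simp: G_def graph_power_def cycle_graph_def)
  qed auto
  \<comment> \<open>A single class would be the whole graph, whose degree is constant;
    \<open>m = 0\<close> fails because the edge \<open>{0, 1}\<close> has a color.\<close>
  have lower: "2 \<le> m" if "locally_irregular_coloring G m c" for m c
  proof (rule ccontr)
    assume "\<not> 2 \<le> m"
    moreover have "c {0, 1} < m"
      using edge01 that by (auto simp: locally_irregular_coloring_def)
    ultimately have "m = 1" by linarith
    then have "locally_irregular (edge_induced {e \<in> edges G. c e = 0})"
      "{e \<in> edges G. c e = 0} = edges G"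
      using that by (auto simp: locally_irregular_coloring_def)
    then have "degree G 0 \<noteq> degree G 1"
      using edge01 by (simp add: locally_irregular_def edge_induced_def degree_def)
    then show False
      using deg vert[of 0 1] vert[of 1 0] edge01 by (simp add: insert_commute)
  qed
  define R where "R = {{u, v} | u v. \<rho> u v}"
  have R_iff: "{u, v} \<in> R \<longleftrightarrow> \<rho> u v" for u v
    using sym by (auto simp: R_def doubleton_eq_iff)
  have R_sub: "R \<subseteq> edges G"
    using sub by (auto simp: R_def G_def)
  have R_deg: "degree (edge_induced R) v = card {w. \<rho> v w}" for v
    using degree_eq_card_neighbours[of "edge_induced R" v] card2 R_sub
    by (auto simp: edge_induced_def R_iff)
  \<comment> \<open>\<open>R_le\<close> prevents truncated subtraction from turning distinct red
    degrees into equal complementary degrees.\<close>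
  have B_deg: "degree (edge_induced (edges G - R)) v = 2 * k - card {w. \<rho> v w}"
    and R_le: "card {w. \<rho> v w} \<le> 2 * k" if "v < n" for v
  proof -
    have "{e \<in> R. v \<in> e} \<subseteq> {e \<in> edges G. v \<in> e}"
      using R_sub by auto
    moreover have "{e \<in> edges G - R. v \<in> e} = {e \<in> edges G. v \<in> e} - {e \<in> R. v \<in> e}"
      by auto
    ultimately show "degree (edge_induced (edges G - R)) v = 2 * k - card {w. \<rho> v w}"
      "card {w. \<rho> v w} \<le> 2 * k"
      using deg[OF that] R_deg[of v] fin
      by (auto simp: degree_def edge_induced_def card_Diff_subset finite_subset
          dest: card_mono[rotated])
  qed
  have "locally_irregular_coloring G 2 (\<lambda>e. if e \<in> R then 0 else 1)"
  proof -
    have "{e \<in> edges G. (if e \<in> R then 0 else 1) = (0::nat)} = R"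
      "{e \<in> edges G. (if e \<in> R then 0 else 1) = (1::nat)} = edges G - R"
      using R_sub by auto
    moreover have "locally_irregular (edge_induced R)"
      unfolding locally_irregular_def R_deg using proper R_sub
      by (auto simp: G_def edge_induced_def)
    moreover have "locally_irregular (edge_induced (edges G - R))"
      unfolding locally_irregular_def
    proof (intro allI impI)
      fix u v assume "{u, v} \<in> edges (edge_induced (edges G - R))"
      then have e: "{u, v} \<in> edges G"
        by (simp add: edge_induced_def)
      then have "u < n" "v < n"
        using vert[of u v] vert[of v u] by (auto simp: insert_commute)
      then show "degree (edge_induced (edges G - R)) u \<noteq> degree (edge_induced (edges G - R)) v"
        using proper[of u v] e R_le[of u] R_le[of v] B_deg[of u] B_deg[of v]
        unfolding G_def by linarith
    qed
    ultimately show ?thesis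
      by (auto simp: locally_irregular_coloring_def less_2_cases_iff)
  qed
  then have "lir G \<le> enat 2"
    unfolding lir_def by (intro INF_lower) auto
  moreover have "enat 2 \<le> lir G"
    unfolding lir_def using lower by (intro INF_greatest) auto
  ultimately show ?thesis
    by (simp add: G_def numeral_eq_enat)
qed

section \<open>The exceptional case \<open>k = 3\<close>, \<open>n = 11\<close>\<close>

text \<open>Here \<open>l = 5\<close>, and the general pattern would need the pair
  \<open>(0, 4)\<close> twice between blocks: as a threshold edge, since \<open>4 > k\<close>, and
  as a matching edge. The adjacency lists \<open>N\<close> give a red graph instead.\<close>

lemma lir_cycle_11_power_3: "lir (graph_power (cycle_graph 11) 3) = 2"
proof -
  define N :: "nat list list" where
    "N = [[2, 10], [10], [0, 5, 10], [], [5, 7], [2, 4, 6, 7, 8], [5], [4, 5, 8, 10],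
      [5, 7, 10], [], [0, 1, 2, 7, 8]]"
  have all11: "(\<forall>u<11. P u) \<longleftrightarrow> P 0 \<and> P 1 \<and> P 2 \<and> P 3 \<and> P 4 \<and> P 5 \<and> P 6 \<and> P 7 \<and> P 8 \<and> P 9 \<and> P 10"
    for P :: "nat \<Rightarrow> bool"
    by (simp add: numeral_eq_Suc All_less_Suc conj_ac)
  \<comment> \<open>Modulo \<open>11\<close>, the displacements \<open>8, 9, 10\<close> are
    \<open>-3, -2, -1\<close>.\<close>
  have edge: "{u, v} \<in> edges (graph_power (cycle_graph 11) 3) \<longleftrightarrow>
      u < 11 \<and> v \<in> (\<lambda>d. (u + d) mod 11) ` {1, 2, 3, 8, 9, 10}" for u v :: nat
  proof (cases "u < 11")
    case True
    have "(0 < d \<and> d \<le> 3 \<or> 11 - 3 \<le> d \<and> d < 11) \<longleftrightarrow> d \<in> {1, 2, 3, 8, 9, 10}" for d :: nat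
      by auto
    moreover have "{u, v} \<in> edges (graph_power (cycle_graph 11) 3) \<longleftrightarrow>
        (\<exists>d. (0 < d \<and> d \<le> 3 \<or> 11 - 3 \<le> d \<and> d < 11) \<and> v = (u + d) mod 11)"
      using True by (intro cycle_power_edge_iff) simp_all
    ultimately show ?thesis
      using True by (simp only: image_iff Bex_def simp_thms)
  next
    case False
    then show ?thesis
      by (auto simp: graph_power_def cycle_graph_def doubleton_eq_iff)
  qed
  have card: "card {w. u < 11 \<and> w \<in> set (N ! u)} = length (N ! u)" if "u < 11" for u
  proof -
    have "\<forall>u<11. distinct (N ! u)"
      by (simp add: all11 N_def)
    then show ?thesis
      using that by (simp add: distinct_card)
  qed
  have red: "\<forall>u<11. \<forall>v\<in>set (N ! u). v < 11 \<and> u \<in> set (N ! v)"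
    and red_edge: "\<forall>u<11. \<forall>v\<in>set (N ! u). v \<in> (\<lambda>d. (u + d) mod 11) ` {1, 2, 3, 8, 9, 10}"
    and proper: "\<forall>u<11. \<forall>v\<in>(\<lambda>d. (u + d) mod 11) ` {1, 2, 3, 8, 9, 10}.
      length (N ! u) \<noteq> length (N ! v)"
    by (simp_all add: all11 N_def)
  show ?thesis
  proof (rule lir_cycle_power_eq_2I[where \<rho> = "\<lambda>u v. u < 11 \<and> v \<in> set (N ! u)"])
    show "v < 11 \<and> u \<in> set (N ! v)" if "u < 11 \<and> v \<in> set (N ! u)" for u v
      using that red by blast
    show "{u, v} \<in> edges (graph_power (cycle_graph 11) 3)" if "u < 11 \<and> v \<in> set (N ! u)" for u v
      using that red_edge unfolding edge by blast
    show "card {w. u < 11 \<and> w \<in> set (N ! u)} \<noteq> card {w. v < 11 \<and> w \<in> set (N ! v)}"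
      if "{u, v} \<in> edges (graph_power (cycle_graph 11) 3)" for u v
    proof -
      have "u < 11" "v < 11"
        using that edge[of u v] edge[of v u] unfolding insert_commute[of v u] by blast+
      moreover have "length (N ! u) \<noteq> length (N ! v)"
        using that proper unfolding edge by blast
      ultimately show ?thesis
        using card[of u] card[of v] by simp
    qed
  qed simp_all
qed

section \<open>The degree pattern on one block\<close>

text \<open>\<open>I p x\<close>: positions \<open>p\<close> and \<open>x\<close> of the same block are joined. \<open>C p x\<close> with \<open>x < p\<close>: position \<open>p\<close>
  of a block is joined to position \<open>x\<close> of the next block, whose distance is at most
  \<open>l + 1 - (p - x)\<close>.\<close>

lemma block_pattern:
  fixes k l :: nat
  assumes "2 \<le> k" "k < l" "2 * l \<le> 3 * k + 1" and not_5: "\<not> (k = 3 \<and> l = 5)"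
  obtains I C :: "nat \<Rightarrow> nat \<Rightarrow> bool" where
    "\<And>p x. I p x \<Longrightarrow> I x p"
    "\<And>p x. I p x \<Longrightarrow> p < l \<and> p \<noteq> x \<and> p \<le> x + k"
    "\<And>p x. C p x \<Longrightarrow> C x p"
    "\<And>p x. C p x \<Longrightarrow> p < l \<and> p \<noteq> x \<and> (x < p \<longrightarrow> l + 1 \<le> p - x + k)"
    "inj_on (\<lambda>p. card {x. I p x} + card {x. C p x}) {..<l}"
    "\<And>p. p < l \<Longrightarrow> 0 < card {x. I p x} + card {x. C p x}"
proof -
  \<comment> \<open>\<open>h\<close> is the number of heavy weights, those \<open>y\<close> with
    \<open>l + 1 \<le> 2 * y\<close>. Of the heavy positions, \<open>b\<close> lie at the front of
    the block and the other \<open>h - b\<close> start at position \<open>h\<close>.\<close>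
  define h where "h = (l + 1) div 2"
  define b where "b = h div 2"
  have h: "2 * h = l \<or> 2 * h = l + 1"
    unfolding h_def by presburger
  have b: "h = 2 * b \<or> h = 2 * b + 1"
    unfolding b_def by presburger
  have bounds: "1 \<le> b" "h \<le> k" "l + 1 \<le> h + k"
    using h b assms(1-3) by linarith+
  \<comment> \<open>For odd \<open>h\<close> the position \<open>b - 1\<close> is also matched with
    \<open>h + b\<close>, at difference \<open>h + 1\<close>. This is where the exceptional case has
    to be excluded.\<close>
  have odd_bound: "h + 1 \<le> k" if "h = 2 * b + 1"
  proof (rule ccontr)
    assume "\<not> h + 1 \<le> k"
    then have "b = 1"
      using that h bounds(1) assms(3) by linarith
    with \<open>\<not> h + 1 \<le> k\<close> have "k = 3" "l = 5"
      using that h bounds assms(3) by linarith+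
    then show False
      using not_5 by blast
  qed
  \<comment> \<open>\<open>H\<close> is the set of heavy positions, \<open>b - 1\<close> the heaviest one, \<open>D\<close> the matching, which pairs
    \<open>p < b\<close> with \<open>h + p\<close>.\<close>
  define H where "H = {..<b} \<union> {h..<2 * h - b}"
  \<comment> \<open>The weights above \<open>l - h\<close> go to \<open>H\<close>, the largest of
    them to \<open>b - 1\<close>. Beyond this, only bijectivity onto \<open>{1..l}\<close> matters
    later.\<close>
  define w where "w p = (if p < b then l + p + 1 - b else if p < h then p + 1 - b
    else if p < 2 * h - b then l + h - b - p else p + 1 - h)" for p
  have w_H: "l + 1 \<le> 2 * w p \<longleftrightarrow> p \<in> H" if "p < l" for p
    using that h b bounds(1) by (auto simp: w_def H_def)
  have w_inj: "inj_on w {..<l}"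
    using h b bounds(1) by (intro inj_onI) (auto simp: w_def split: if_splits)
  have w_range: "w p \<in> {1..l}" if "p < l" for p
    using that h b bounds(1) by (auto simp: w_def)
  have w_image: "w ` {..<l} = {1..l}"
    using w_inj w_range by (intro card_subset_eq) (auto simp: card_image)
  have w_top: "w (b - 1) = l"
    using bounds(1) h b by (auto simp: w_def)
  define S where "S p x \<longleftrightarrow> p < l \<and> x < l \<and> p \<noteq> x \<and> l + 1 \<le> w p + w x" for p x
  have card_S: "card {x. S p x} = w p - (if p \<in> H then 1 else 0)" if p: "p < l" for p
  proof -
    let ?N = "{x \<in> {..<l}. l + 1 \<le> w p + w x}"
    have "w ` ?N = {l + 1 - w p..l}"
    proof -
      have "w ` ?N = {y \<in> w ` {..<l}. l + 1 \<le> w p + y}"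
        by auto
      then show ?thesis
        using w_range[OF p] by (auto simp: w_image)
    qed
    moreover have "card (w ` ?N) = card ?N"
      using w_inj by (intro card_image) (auto intro: inj_on_subset)
    ultimately have "card ?N = w p"
      using w_range[OF p] by simp
    moreover have "{x. S p x} = ?N - {p}"
      using p by (auto simp: S_def)
    moreover have "p \<in> ?N \<longleftrightarrow> p \<in> H"
      using w_H[OF p] p by (simp add: mult_2)
    ultimately show ?thesis
      by (simp add: card_Diff_singleton_if)
  qed
  \<comment> \<open>\<open>p\<close> is the front partner of \<open>x\<close>. The minimum takes
    effect only for odd \<open>h\<close>, where it assigns the last heavy position
    \<open>h + b\<close> to \<open>b - 1\<close>.\<close>
  define D0 where "D0 p x \<longleftrightarrow> h \<le> x \<and> x < 2 * h - b \<and> p = min (x - h) (b - 1)" for p x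
  define D where "D p x \<longleftrightarrow> D0 p x \<or> D0 x p" for p x
  \<comment> \<open>The bound \<open>h + p \<le> x\<close> makes the pair close enough between
    blocks, as \<open>l + 1 \<le> h + k\<close>; the bound \<open>x \<le> p + k\<close> keeps it out
    of \<open>Far\<close>, so that no edge is counted twice.\<close>
  have D0: "p < b \<and> x < l \<and> h + p \<le> x \<and> x \<le> p + k" if "D0 p x" for p x
    using that h b bounds odd_bound by (auto simp: D0_def min_def split: if_splits)
  have "b \<le> h"
    using b by auto
  have card_D: "card {x. D p x} = (if p = b - 1 then h - 2 * b + 1 else if p \<in> H then 1 else 0)"
    if p: "p < l" for p
  proof -
    consider "p < b - 1" | "p = b - 1" | "b \<le> p" "p < h" | "h \<le> p" "p < 2 * h - b" | "2 * h - b \<le> p"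
      using bounds(1) by linarith
    then show ?thesis
    proof cases
      case 1
      have "\<not> D0 x p" for x
        using 1 \<open>b \<le> h\<close> by (auto simp: D0_def)
      moreover have "D0 p x \<longleftrightarrow> x = p + h" for x
        using 1 b by (auto simp: D0_def)
      ultimately show ?thesis
        using 1 by (auto simp: D_def H_def)
    next
      case 2
      have "\<not> D0 x p" for x
        using 2 \<open>b \<le> h\<close> bounds(1) by (auto simp: D0_def)
      moreover have "D0 p x \<longleftrightarrow> x \<in> {h + b - 1..<2 * h - b}" for x
        using 2 \<open>b \<le> h\<close> bounds(1) by (auto simp: D0_def)
      ultimately have "{x. D p x} = {h + b - 1..<2 * h - b}"
        by (auto simp: D_def)
      then show ?thesis using 2 b bounds(1) by auto
    next
      case 3
      then have "\<not> D p x" for x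
        using D0[of p x] by (auto simp: D_def D0_def)
      then show ?thesis using 3 bounds(1) by (auto simp: H_def)
    next
      case 4
      have "\<not> D0 p x" for x
        using 4 \<open>b \<le> h\<close> D0[of p x] by auto
      moreover have "D0 x p \<longleftrightarrow> x = min (p - h) (b - 1)" for x
        using 4 by (simp add: D0_def)
      ultimately show ?thesis
        using 4 \<open>b \<le> h\<close> bounds(1) by (auto simp: D_def H_def)
    next
      case 5
      then have "\<not> D p x" for x
        using D0[of p x] b by (auto simp: D_def D0_def)
      then show ?thesis using 5 b bounds(1) by (auto simp: H_def)
    qed
  qed
  define I where "I p x \<longleftrightarrow> S p x \<and> p \<le> x + k \<and> x \<le> p + k" for p x
  define Far where "Far p x \<longleftrightarrow> S p x \<and> (p + k < x \<or> x + k < p)" for p x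
  define C where "C p x \<longleftrightarrow> D p x \<or> Far p x" for p x
  have fin: "finite {x. S p x}" "finite {x. D p x}" for p
  proof -
    show "finite {x. S p x}"
      by (rule finite_subset[of _ "{..<l}"]) (auto simp: S_def)
    have "x < l" if "D p x" for x
      using that D0[of p x] D0[of x p] by (auto simp: D_def)
    then show "finite {x. D p x}"
      by - (rule finite_subset[of _ "{..<l}"], auto)
  qed
  have "card {x. I p x} + card {x. C p x} = card {x. S p x} + card {x. D p x}" for p
  proof -
    have "{x. S p x} = {x. I p x} \<union> {x. Far p x}" "{x. I p x} \<inter> {x. Far p x} = {}"
      by (auto simp: I_def Far_def)
    then have "card {x. S p x} = card {x. I p x} + card {x. Far p x}"
      using fin(1)[of p] by (metis card_Un_disjoint finite_Un)
    moreover have "{x. C p x} = {x. D p x} \<union> {x. Far p x}"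
      by (auto simp: C_def)
    moreover have "\<not> Far p x" if "D p x" for x
      using that D0[of p x] D0[of x p] by (auto simp: D_def Far_def)
    then have "{x. D p x} \<inter> {x. Far p x} = {}"
      by blast
    moreover have "finite {x. Far p x}"
      using fin(1)[of p] by (rule finite_subset[rotated]) (auto simp: Far_def)
    ultimately show ?thesis
      using fin(2)[of p] by (simp add: card_Un_disjoint)
  qed
  \<comment> \<open>The matching returns the \<open>1\<close> lost by each heavy position. The
    heaviest one ends with \<open>l\<close> or \<open>l + 1\<close>, still above all others by
    \<open>w_less\<close>.\<close>
  moreover have "card {x. S p x} + card {x. D p x} = (if p = b - 1 then l + (h - 2 * b) else w p)"
    if "p < l" for p
    using card_S[OF that] card_D[OF that] w_range[OF that] w_top bounds(1) by (auto simp: H_def)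
  ultimately have total: "card {x. I p x} + card {x. C p x} =
      (if p = b - 1 then l + (h - 2 * b) else w p)" if "p < l" for p
    using that by metis
  have w_less: "w p < l" if "p < l" "p \<noteq> b - 1" for p
  proof -
    have "b - 1 < l"
      using h \<open>b \<le> h\<close> bounds(1) by linarith
    then have "w p \<noteq> l"
      using inj_onD[OF w_inj, of p "b - 1"] that w_top by auto
    then show ?thesis
      using w_range[OF that(1)] by simp
  qed
  show thesis
  proof
    show "I p x \<Longrightarrow> I x p" for p x
      by (auto simp: I_def S_def add.commute)
    show "I p x \<Longrightarrow> p < l \<and> p \<noteq> x \<and> p \<le> x + k" for p x
      by (auto simp: I_def S_def)
    show "C p x \<Longrightarrow> C x p" for p x
      by (auto simp: C_def D_def Far_def S_def add.commute)
    show "p < l \<and> p \<noteq> x \<and> (x < p \<longrightarrow> l + 1 \<le> p - x + k)" if "C p x" for p x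
      using that D0[of p x] D0[of x p] bounds assms h b
      by (auto simp: C_def D_def Far_def S_def)
    show "inj_on (\<lambda>p. card {x. I p x} + card {x. C p x}) {..<l}"
    proof (rule inj_onI)
      fix p x assume *: "p \<in> {..<l}" "x \<in> {..<l}"
        "card {x. I p x} + card {x. C p x} = card {y. I x y} + card {y. C x y}"
      then show "p = x"
        using w_less[of p] w_less[of x] inj_onD[OF w_inj, of p x]
        by (auto simp: total split: if_splits)
    qed
    show "0 < card {x. I p x} + card {x. C p x}" if "p < l" for p
      using total[OF that] w_range[OF that] assms by auto
  qed
qed

section \<open>Assembling the blocks around the cycle\<close>

text \<open>The first \<open>e\<close> of \<open>q\<close> cyclically arranged blocks get an extra
  vertex at position \<open>l\<close>. Red degrees determine the position, so equal ones are at
  least a whole block apart, which exceeds \<open>k\<close>.\<close>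

lemma lir_cycle_power_from_pattern:
  fixes I C :: "nat \<Rightarrow> nat \<Rightarrow> bool"
  assumes "0 < k" "k < l" "2 \<le> q" "e \<le> q"
    and I_sym: "\<And>p x. I p x \<Longrightarrow> I x p"
    and I: "\<And>p x. I p x \<Longrightarrow> p < l \<and> p \<noteq> x \<and> p \<le> x + k"
    and C_sym: "\<And>p x. C p x \<Longrightarrow> C x p"
    and C: "\<And>p x. C p x \<Longrightarrow> p < l \<and> p \<noteq> x \<and> (x < p \<longrightarrow> l + 1 \<le> p - x + k)"
    and inj: "inj_on (\<lambda>p. card {x. I p x} + card {x. C p x}) {..<l}"
    and pos: "\<And>p. p < l \<Longrightarrow> 0 < card {x. I p x} + card {x. C p x}"
  shows "lir (graph_power (cycle_graph (q * l + e)) k) = 2"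
proof -
  define n where "n = q * l + e"
  define len where "len b = (if b < e then l + 1 else l)" for b
  \<comment> \<open>The first vertex of block \<open>b\<close>; \<open>min b e\<close> counts the
    long blocks before it.\<close>
  define S where "S b = b * l + min b e" for b
  define F where "F p = card {x. I p x} + card {x. C p x}" for p
  have S_Suc: "S (Suc b) = S b + len b" for b
    by (simp add: S_def len_def)
  have S_0: "S 0 = 0" and S_q: "S q = n"
    using assms(4) by (simp_all add: S_def n_def)
  have S_mono: "S a \<le> S b" if "a \<le> b" for a b
    using that by (auto simp: S_def intro!: add_mono mult_le_mono1 min.mono)
  have len: "l \<le> len b" "len b \<le> l + 1" for b
    by (auto simp: len_def)
  have "2 * l \<le> q * l"
    using assms(3) by (rule mult_le_mono1)
  then have n: "2 * k < n"
    using assms(2) unfolding n_def by linarith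
  have less_n: "S b + p < n" if "b < q" "p < len b" for b p
    using S_mono[of "Suc b" q] that by (simp add: S_Suc S_q)
  have ex: "\<exists>b p. b < m \<and> p < len b \<and> v = S b + p" if "v < S m" for v m
    using that
  proof (induction m)
    case 0
    then show ?case by (simp add: S_0)
  next
    case (Suc m)
    show ?case
    proof (cases "v < S m")
      case True
      then show ?thesis using Suc.IH less_SucI by blast
    next
      case False
      then show ?thesis
        using Suc.prems by (intro exI[of _ m] exI[of _ "v - S m"]) (auto simp: S_Suc)
    qed
  qed
  have uniq: "b = b' \<and> p = p'" if "p < len b" "p' < len b'" "S b + p = S b' + p'" for b p b' p'
    using that S_mono[of "Suc b" b'] S_mono[of "Suc b'" b]
    by (cases b b' rule: linorder_cases) (auto simp: S_Suc)
  define nx where "nx b = Suc b mod q" for b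
  have nx: "nx b < q" "nx b \<noteq> b" if "b < q" for b
    using that assms(3) by (auto simp: nx_def mod_if)
  define pv where "pv b = (if b = 0 then q - 1 else b - 1)" for b
  have pv: "b' = pv b \<longleftrightarrow> b = nx b'" "pv b < q" if "b < q" "b' < q" for b b'
    using that by (auto simp: nx_def pv_def mod_if)
  \<comment> \<open>Edges between blocks run from the larger position to the smaller one in the next
    block, hence are shorter than a block.\<close>
  define RR where "RR b p b' p' \<longleftrightarrow> b < q \<and> b' < q \<and>
    (b' = b \<and> I p p' \<or> b' = nx b \<and> p' < p \<and> C p p' \<or> b = nx b' \<and> p < p' \<and> C p p')"
    for b p b' p'
  have RR_sym: "RR b' p' b p" if "RR b p b' p'" for b p b' p'
    using that I_sym C_sym by (auto simp: RR_def)
  have RR_l: "p < l \<and> p' < l" if "RR b p b' p'" for b p b' p'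
    using that I[of p p'] I[of p' p] I_sym[of p p'] C[of p p'] C[of p' p] C_sym[of p p']
    by (auto simp: RR_def)
  define \<rho> where "\<rho> u v \<longleftrightarrow> (\<exists>b p b' p'. u = S b + p \<and> v = S b' + p' \<and> RR b p b' p')" for u v
  have \<rho>_iff: "\<rho> (S b + p) v \<longleftrightarrow> (\<exists>b' p'. v = S b' + p' \<and> RR b p b' p')"
    if "p < len b" for b p v
  proof
    assume "\<rho> (S b + p) v"
    then obtain c x b' p' where *: "S b + p = S c + x" "v = S b' + p'" "RR c x b' p'"
      by (auto simp: \<rho>_def)
    then have "x < len c"
      using RR_l len(1)[of c] by (meson order_less_le_trans)
    then show "\<exists>b' p'. v = S b' + p' \<and> RR b p b' p'"
      using uniq[OF that _ *(1)] * by blast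
  qed (auto simp: \<rho>_def)
  have card_\<rho>: "card {w. \<rho> (S b + p) w} = F p" if "b < q" "p < len b" for b p
  proof -
    \<comment> \<open>For \<open>q = 2\<close> the next and the previous block coincide;
      \<open>?B\<close> and \<open>?C\<close> stay disjoint because they lie on different sides of
      \<open>p\<close>.\<close>
    let ?A = "{b} \<times> {x. I p x}" and ?B = "{nx b} \<times> {x. x < p \<and> C p x}"
      and ?C = "{pv b} \<times> {x. p < x \<and> C p x}"
    have finI: "finite {x. I p x}"
      using I[OF I_sym, of p] by - (rule finite_subset[of _ "{..<l}"], auto)
    have finC: "finite {x. C p x}"
      using C[OF C_sym, of p] by - (rule finite_subset[of _ "{..<l}"], auto)
    have RR_eq: "RR b p b' x \<longleftrightarrow> (b', x) \<in> ?A \<union> ?B \<union> ?C" for b' x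
      using that nx(1)[of b] pv[of b b'] pv(2)[of b b] by (auto simp: RR_def)
    have "{w. \<rho> (S b + p) w} = (\<lambda>(b', x). S b' + x) ` {(b', x). RR b p b' x}"
      by (auto simp: \<rho>_iff[OF that(2)] image_iff)
    also have "{(b', x). RR b p b' x} = ?A \<union> ?B \<union> ?C"
      using RR_eq by auto
    finally have "{w. \<rho> (S b + p) w} = (\<lambda>(b', x). S b' + x) ` (?A \<union> ?B \<union> ?C)" .
    moreover have "inj_on (\<lambda>(b', x). S b' + x) (?A \<union> ?B \<union> ?C)"
    proof (rule inj_onI, clarify)
      fix b1 x1 b2 x2
      assume *: "(b1, x1) \<in> ?A \<union> ?B \<union> ?C" "(b2, x2) \<in> ?A \<union> ?B \<union> ?C" "S b1 + x1 = S b2 + x2"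
      then have "x1 < l" "x2 < l"
        using RR_eq RR_l by blast+
      then show "b1 = b2 \<and> x1 = x2"
        using uniq[of x1 b1 x2 b2] * len(1)[of b1] len(1)[of b2] by simp
    qed
    moreover have "card (?A \<union> ?B \<union> ?C) = F p"
    proof -
      have "\<not> C p p"
        using C by blast
      then have split: "{x. C p x} = {x. x < p \<and> C p x} \<union> {x. p < x \<and> C p x}"
        by (auto, metis linorder_neqE_nat)
      have fin: "finite {x. x < p \<and> C p x}" "finite {x. p < x \<and> C p x}"
        by (rule finite_subset[OF _ finC], auto)+
      have "card {x. C p x} = card {x. x < p \<and> C p x} + card {x. p < x \<and> C p x}"
        unfolding split by (rule card_Un_disjoint) (use fin in auto)
      moreover have "card (?A \<union> ?B \<union> ?C) = card (?A \<union> ?B) + card ?C"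
        by (rule card_Un_disjoint) (use finI fin that nx(2)[of b] pv(1)[of b b] in auto)
      moreover have "card (?A \<union> ?B) = card ?A + card ?B"
        by (rule card_Un_disjoint) (use finI fin that nx(2)[of b] in auto)
      ultimately show ?thesis
        by (simp add: F_def card_cartesian_product_singleton)
    qed
    ultimately show ?thesis
      by (simp add: card_image)
  qed
  have "\<not> I l x" "\<not> C l x" for x
    using I C by blast+
  then have F_l: "F l = 0"
    by (simp add: F_def)
  \<comment> \<open>The value \<open>0\<close> at the extra position \<open>l\<close> differs from
    the positive values at all other positions.\<close>
  have F_inj: "p = x" if "p \<le> l" "x \<le> l" "F p = F x" for p x
    using that inj_onD[OF inj, of p x] pos[of p] pos[of x] F_l by (force simp: F_def le_less)
  have edges_eq: "edges (graph_power (cycle_graph n) k) =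
      {{u, (u + d) mod n} | u d. u < n \<and> 0 < d \<and> d \<le> k}"
    using n by (intro cycle_power_edges) simp
  have edgeI: "{u, v} \<in> edges (graph_power (cycle_graph n) k)"
    if "v = (u + d) mod n" "u < n" "0 < d" "d \<le> k" for u v d
    using that unfolding edges_eq by blast
  have inner: "{S b + p, S b + p'} \<in> edges (graph_power (cycle_graph n) k)"
    if "b < q" "p < p'" "I p p'" for b p p'
    using that I[of p' p] I_sym[of p p'] less_n[of b p] less_n[of b p'] len(1)[of b]
    by (intro edgeI[of _ _ "p' - p"]) auto
  have cross: "{S b + p, S (nx b) + p'} \<in> edges (graph_power (cycle_graph n) k)"
    if "b < q" "p' < p" "C p p'" for b p p'
  \<comment> \<open>The forward distance to the next block. A long block makes it
    \<open>l + 1 - (p - p')\<close>, whence the \<open>l + 1\<close> in the bound on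
    \<open>C\<close>.\<close>
  proof (rule edgeI[of _ _ "len b - (p - p')"])
    have p: "p < l" "l + 1 \<le> p - p' + k"
      using C[OF that(3)] that(2) by auto
    have sum: "S b + p + (len b - (p - p')) = S (Suc b) + p'"
      using p(1) that(2) len(1)[of b] by (simp add: S_Suc)
    show "S (nx b) + p' = (S b + p + (len b - (p - p'))) mod n"
    proof (cases "Suc b = q")
      case True
      then show ?thesis
        unfolding sum using p(1) that(2) less_n[of 0 p'] len(1)[of 0]
        by (simp add: nx_def S_0 S_q)
    next
      case False
      then show ?thesis
        unfolding sum using p(1) that(1,2) less_n[of "Suc b" p'] len(1)[of "Suc b"]
        by (simp add: nx_def)
    qed
    show "S b + p < n"
      using less_n[of b p] p(1) len(1)[of b] that(1) by simp
    show "0 < len b - (p - p')" "len b - (p - p') \<le> k"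
      using p len[of b] by auto
  qed
  have "lir (graph_power (cycle_graph n) k) = 2"
  proof (rule lir_cycle_power_eq_2I[where \<rho> = \<rho>])
    show "\<rho> v u" if "\<rho> u v" for u v
      using that RR_sym unfolding \<rho>_def by blast
    show "{u, v} \<in> edges (graph_power (cycle_graph n) k)" if "\<rho> u v" for u v
    proof -
      from that obtain b p b' p' where uv: "u = S b + p" "v = S b' + p'" and "RR b p b' p'"
        by (auto simp: \<rho>_def)
      then consider "b' = b" "b < q" "I p p'" | "b' = nx b" "b < q" "p' < p" "C p p'"
        | "b = nx b'" "b' < q" "p < p'" "C p p'"
        by (auto simp: RR_def)
      then show ?thesis
      proof cases
        case 1
        then have "p \<noteq> p'"
          using I by blast
        then show ?thesis
          using 1 uv inner[of b p p'] inner[of b p' p] I_sym[of p p']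
          by (cases p p' rule: linorder_cases) (auto simp: insert_commute)
      next
        case 2
        then show ?thesis using uv cross by simp
      next
        case 3
        then show ?thesis
          using uv cross[of b' p p'] C_sym[of p p'] by (simp add: insert_commute)
      qed
    qed
    have step: "card {w. \<rho> u w} \<noteq> card {w. \<rho> v w}"
      if uvd: "v = (u + d) mod n" "u < n" "0 < d" "d \<le> k" for u v d
    proof
      assume eq: "card {w. \<rho> u w} = card {w. \<rho> v w}"
      obtain b p where u: "b < q" "p < len b" "u = S b + p"
        using ex[of u q] uvd(2) S_q by auto
      obtain b' p' where v: "b' < q" "p' < len b'" "v = S b' + p'"
      proof -
        have "v < S q"
          using uvd(1,2) by (simp add: S_q)
        then show thesis
          using ex[of v q] that by blast
      qed
      have "p = p'"
      proof (rule F_inj)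
        show "p \<le> l" "p' \<le> l"
          using u(2) v(2) len(2)[of b] len(2)[of b'] by linarith+
        show "F p = F p'"
          using eq u v by (simp add: card_\<rho>)
      qed
      \<comment> \<open>With equal positions, \<open>d\<close> is the forward distance between two
        block starts, hence at least \<open>l\<close>; the second case passes the end of the
        cycle.\<close>
      show False
      proof (cases "u + d < n")
        case True
        then have "S b' = S b + d"
          using uvd u v \<open>p = p'\<close> by simp
        moreover have "b < b'"
          using calculation S_mono[of b' b] uvd(3) by (metis add_diff_cancel_left' diff_is_0_eq leI not_gr0)
        ultimately show False
          using S_mono[of "Suc b" b'] len(1)[of b] uvd(4) assms(2) by (simp add: S_Suc)
      next
        case False
        moreover have "u + d - n < n"
          using uvd(2,4) n by linarith
        ultimately have "v + n = u + d"
          using uvd(1) by (simp add: mod_if)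
        then have "S b' + n = S b + d"
          using u v \<open>p = p'\<close> by simp
        moreover have "S b + l \<le> n"
          using S_mono[of "Suc b" q] u(1) len(1)[of b] by (simp add: S_Suc S_q)
        ultimately show False
          using uvd(4) assms(2) by simp
      qed
    qed
    show "card {w. \<rho> u w} \<noteq> card {w. \<rho> v w}"
      if "{u, v} \<in> edges (graph_power (cycle_graph n) k)" for u v
    proof -
      from that obtain a d where *: "{u, v} = {a, (a + d) mod n}" "a < n" "0 < d" "d \<le> k"
        unfolding edges_eq by blast
      then show ?thesis
        using step[OF refl *(2-4)] by (auto simp: doubleton_eq_iff)
    qed
  qed (use assms(1) n in auto)
  then show ?thesis
    by (simp add: n_def)
qed

section \<open>Cutting the cycle into balanced blocks\<close>

text \<open>The cycle is cut into as many blocks of length at least \<open>k + 1\<close> as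
  possible, and the remainder \<open>r \<le> k\<close> is spread evenly over these two or more
  blocks.\<close>

lemma balanced_block_decomposition:
  fixes k n :: nat
  assumes "1 \<le> k" "2 * k + 2 \<le> n"
  obtains q l e where "n = q * l + e" "2 \<le> q" "e \<le> q" "k < l" "2 * l \<le> 3 * k + 1"
    "k = 3 \<Longrightarrow> l = 5 \<Longrightarrow> n = 11"
proof -
  define q where "q = n div (k + 1)"
  define r where "r = n mod (k + 1)"
  have n: "n = q * (k + 1) + r"
    unfolding q_def r_def by (rule div_mult_mod_eq[symmetric])
  have r: "r \<le> k"
    using mod_less_divisor[of "k + 1" n] by (simp add: r_def)
  have q: "2 \<le> q"
    using assms(2) by (simp add: q_def less_eq_div_iff_mult_less_eq)
  show thesis
  proof (cases "r = 0")
    case True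
    then show ?thesis
      using n q assms(1) by (intro that[of q "k + 1" 0]) auto
  next
    case False
    \<comment> \<open>Dividing \<open>r - 1\<close> puts \<open>e\<close> into
      \<open>{1..q}\<close>: if \<open>q\<close> divides \<open>r\<close>, all blocks become long
      instead of \<open>l\<close> growing. Hence \<open>2 * a \<le> r - e < k\<close>.\<close>
    define a where "a = (r - 1) div q"
    define e where "e = Suc ((r - 1) mod q)"
    have ae: "r = q * a + e"
      using False by (simp add: a_def e_def)
    have "2 * a \<le> q * a"
      using q by simp
    then have a: "2 * a + 1 \<le> k"
      using ae r unfolding e_def by linarith
    show ?thesis
    proof (rule that[of q "k + 1 + a" e])
      show "n = q * (k + 1 + a) + e"
        by (simp add: n ae algebra_simps)
      show "e \<le> q"
        using q by (simp add: e_def Suc_le_eq)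
      show "n = 11" if "k = 3" "k + 1 + a = 5"
      proof -
        have "a = 1"
          using that by simp
        then have "q = 2" "r = 3"
          using ae r q that(1) by (auto simp: e_def)
        then show ?thesis
          using n that(1) by simp
      qed
    qed (use q a in auto)
  qed
qed

theorem mainTheorem10:
  fixes k n :: nat
  assumes "k \<ge> 2" and "n \<ge> 2 * k + 2"
  shows "lir (graph_power (cycle_graph n) k) = 2"
proof -
  have "1 \<le> k"
    using assms(1) by simp
  then obtain q l e where n: "n = q * l + e" "2 \<le> q" "e \<le> q" and l: "k < l" "2 * l \<le> 3 * k + 1"
    and exceptional: "k = 3 \<Longrightarrow> l = 5 \<Longrightarrow> n = 11"
    using balanced_block_decomposition[OF _ assms(2)] by blast
  show ?thesis
  proof (cases "k = 3 \<and> l = 5")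
    case True
    then show ?thesis
      using exceptional lir_cycle_11_power_3 by simp
  next
    case False
    show ?thesis
    proof (rule block_pattern[OF assms(1) l False])
      fix I C :: "nat \<Rightarrow> nat \<Rightarrow> bool"
      assume pattern:
        "\<And>p x. I p x \<Longrightarrow> I x p"
        "\<And>p x. I p x \<Longrightarrow> p < l \<and> p \<noteq> x \<and> p \<le> x + k"
        "\<And>p x. C p x \<Longrightarrow> C x p"
        "\<And>p x. C p x \<Longrightarrow> p < l \<and> p \<noteq> x \<and> (x < p \<longrightarrow> l + 1 \<le> p - x + k)"
        "inj_on (\<lambda>p. card {x. I p x} + card {x. C p x}) {..<l}"
        "\<And>p. p < l \<Longrightarrow> 0 < card {x. I p x} + card {x. C p x}"
      have "0 < k"
        using assms(1) by simp
      then show ?thesis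
        unfolding n(1) by (rule lir_cycle_power_from_pattern[OF _ l(1) n(2,3) pattern])
    qed
  qed
qed

end
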